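(* There is a set $X \subseteq \omega^{\uparrow\omega}$ with $X \in \ell^0$ and $X \notin r^0$, i.e. $\ell^0 \setminus r^0 \neq \emptyset$.
   Context: $\omega^{\uparrow<\omega}$ denotes the set of strictly increasing finite sequences of natural numbers and $\omega^{\uparrow\omega}$ the set of strictly increasing infinite sequences (identified with infinite subsets of $\omega$ via increasing enumeration). A tree is a nonempty subset $T\subseteq\omega^{\uparrow<\omega}$ closed under initial segments; $[T]$ is its set of infinite branches in $\omega^{\uparrow\omega}$. For a family $\mathbb P$ of trees, the associated ideal consists of all $X\subseteq\omega^{\uparrow\omega}$ such that for every $T\in\mathbb P$ there is $T'\in\mathbb P$ with $T'\subseteq T$ and $[T']\cap X=\emptyset$. A Laver tree is a tree $T$ with a node $s$ (the stem) such that every node of $T$ is comparable with $s$ and every node of $T$ extending $s$ has infinitely many immediate successors in $T$; $\ell^0$ is the ideal associated with Laver trees. A Mathias tree is determined by a finite set $s\subseteq\omega$ and an infinite set $A\subseteq\omega$ with $\max s<\min A$; it is the tree of all finite initial segments of increasing enumerations of sets $s\cup y$ with $y\subseteq A$ infinite; $r^0$ is the ideal associated with Mathias trees. *)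

theory Defs
  imports "HOL-Library.Infinite_Set" "HOL-Library.Sublist"
begin

definition inc_fin :: "nat list set" where
  "inc_fin = {s. sorted_wrt (<) s}"

definition inc_inf :: "(nat \<Rightarrow> nat) set" where
  "inc_inf = {x. strict_mono x}"

definition is_tree :: "nat list set \<Rightarrow> bool" where
  "is_tree T \<longleftrightarrow> T \<noteq> {} \<and> T \<subseteq> inc_fin \<and> (\<forall>t\<in>T. \<forall>s. prefix s t \<longrightarrow> s \<in> T)"

definition branches :: "nat list set \<Rightarrow> (nat \<Rightarrow> nat) set" where
  "branches T = {x \<in> inc_inf. \<forall>n. map x [0..<n] \<in> T}"

definition tree_ideal :: "nat list set set \<Rightarrow> (nat \<Rightarrow> nat) set set" where
  "tree_ideal P =
     {X. X \<subseteq> inc_inf \<and> (\<forall>T\<in>P. \<exists>T'\<in>P. T' \<subseteq> T \<and> branches T' \<inter> X = {})}"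

definition laver_trees :: "nat list set set" where
  "laver_trees =
     {T. is_tree T \<and>
         (\<exists>s\<in>T. (\<forall>t\<in>T. prefix t s \<or> prefix s t) \<and>
                (\<forall>t\<in>T. prefix s t \<longrightarrow> infinite {n. t @ [n] \<in> T}))}"

text \<open>For infinite \<open>S\<close>, \<open>enumerate S\<close> is the increasing enumeration of \<open>S\<close>.\<close>

definition mathias_tree :: "nat set \<Rightarrow> nat set \<Rightarrow> nat list set" where
  "mathias_tree s A =
     {map (enumerate (s \<union> y)) [0..<n] | y n. y \<subseteq> A \<and> infinite y}"

text \<open>The condition \<open>max s < min A\<close> is written elementwise, so that \<open>s = {}\<close> is allowed.\<close>

definition mathias_trees :: "nat list set set" where
  "mathias_trees =
     {mathias_tree s A | s A. finite s \<and> infinite A \<and> (\<forall>m\<in>s. \<forall>n\<in>A. m < n)}"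

definition laver_ideal :: "(nat \<Rightarrow> nat) set set" where
  "laver_ideal = tree_ideal laver_trees"

definition mathias_ideal :: "(nat \<Rightarrow> nat) set set" where
  "mathias_ideal = tree_ideal mathias_trees"

end

theory Submission
  imports Defs "HOL-Library.Countable"
begin

unbundle cardinal_syntax

text \<open>Call a set of sequences almost disjoint if the ranges of any two of its distinct
members have finite intersection. Every Laver tree contains continuum many Laver trees with pairwise
disjoint, almost disjoint sets of branches. On the other hand every Mathias tree has continuum
many branches any two of which have infinitely many values in common, so an almost disjoint set
contains at most one of them. Hence one can run a recursion of length continuum that picks a branch
in every Mathias tree and a subtree of every Laver tree such that no picked branch runs through a
picked subtree: each step has to avoid fewer than continuum many of its candidates.\<close>

text \<open>If every candidate were related to some member of \<open>Y\<close>, choosing such a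
  member for each would by \<open>unique\<close> embed all candidates into the smaller set
  \<open>Y\<close>.\<close>

lemma ex_unrelated:
  assumes less: "|Y| <o |UNIV :: 'f set|"
    and unique: "\<And>y F G. y \<in> Y \<Longrightarrow> R y F \<Longrightarrow> R y G \<Longrightarrow> F = G"
  shows "\<exists>F :: 'f. \<forall>y\<in>Y. \<not> R y F"
proof (rule ccontr)
  assume "\<not> ?thesis"
  then obtain h where h: "\<And>F. h F \<in> Y" "\<And>F. R (h F) F"
    by metis
  have "inj h"
    using h unique by (metis injI)
  then have "|UNIV :: 'f set| \<le>o |Y|"
    using h card_of_ordLeq[of UNIV Y] by blast
  then show False
    using less not_ordLess_ordLeq by blast
qed

text \<open>The recursion in abstract form: \<open>b i\<close> lists the points available for
  \<open>i\<close>, and \<open>C j\<close> the sets available for \<open>j\<close>. By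
  \<open>meet\<close> an earlier set spoils at most one new point; by \<open>disj\<close> an earlier
  point spoils at most one new set.\<close>

lemma ex_transversal_selection:
  fixes b :: "'i \<Rightarrow> 'f \<Rightarrow> 'a" and C :: "'i \<Rightarrow> 'f \<Rightarrow> 'a set"
  assumes inf: "infinite (UNIV :: 'f set)"
    and le: "|UNIV :: 'i set| \<le>o |UNIV :: 'f set|"
    and meet: "\<And>i j F G H. i \<in> M \<Longrightarrow> j \<in> L \<Longrightarrow> b i F \<in> C j H \<Longrightarrow> b i G \<in> C j H \<Longrightarrow> F = G"
    and disj: "\<And>j x F G. j \<in> L \<Longrightarrow> x \<in> C j F \<Longrightarrow> x \<in> C j G \<Longrightarrow> F = G"
  shows "\<exists>f g. \<forall>i\<in>M. \<forall>j\<in>L. b i (f i) \<notin> C j (g j)"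
proof -
  define r where "r = |UNIV :: 'i set|"
  have wo: "Well_order r" and co: "Card_order r" and field: "Field r = UNIV"
    unfolding r_def by (fact card_of_Well_order card_of_Card_order Field_card_of)+
  \<comment> \<open>As \<open>r\<close> is a cardinal order, its proper initial segments are smaller
    than the index type, so at every stage fewer choices have been made than there are
    candidates.\<close>
  have under: "|underS r i| <o |UNIV :: 'f set|" for i
    using card_of_underS[OF co, of i] le field unfolding r_def
    by (metis UNIV_I ordLess_ordLeq_trans)
  \<comment> \<open>\<open>P h i p\<close> says that the pair \<open>p\<close> of a point and a set
    is admissible at stage \<open>i\<close> after the earlier choices \<open>h\<close>. The last
    clause covers an index in both \<open>M\<close> and \<open>L\<close>.\<close>
  define P where "P h i p \<longleftrightarrow>
      (i \<in> M \<longrightarrow> (\<forall>j\<in>underS r i \<inter> L. b i (fst p) \<notin> C j (snd (h j)))) \<and>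
      (i \<in> L \<longrightarrow> (\<forall>j\<in>underS r i \<inter> M. b j (fst (h j)) \<notin> C i (snd p)) \<and>
                 (i \<in> M \<longrightarrow> b i (fst p) \<notin> C i (snd p)))"
    for h :: "'i \<Rightarrow> 'f \<times> 'f" and i p
  have "\<exists>h. \<forall>i. P h i (h i)"
  proof (rule dependent_wf_choice[where R = "r - Id"])
    show "wf (r - Id)"
      using wo by (simp add: well_order_on_def)
    show "P h i p = P h' i p" if "\<And>z. (z, i) \<in> r - Id \<Longrightarrow> h z = h' z" for h h' i p
    proof -
      have "h z = h' z" if "z \<in> underS r i" for z
        using that \<open>\<And>z. (z, i) \<in> r - Id \<Longrightarrow> h z = h' z\<close> by (auto simp: underS_def)
      then show ?thesis
        unfolding P_def by auto
    qed
    show "\<exists>p. P h i p" for i h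
    proof -
      have small: "|underS r i \<inter> K| <o |UNIV :: 'f set|" for K
        using under[of i] card_of_mono1[of "underS r i \<inter> K" "underS r i"]
        by (meson inf_le1 ordLeq_ordLess_trans)
      have "\<exists>F. i \<in> M \<longrightarrow> (\<forall>j\<in>underS r i \<inter> L. b i F \<notin> C j (snd (h j)))"
      proof (cases "i \<in> M")
        case True
        then have "\<exists>F. \<forall>j\<in>underS r i \<inter> L. \<not> b i F \<in> C j (snd (h j))"
          by (intro ex_unrelated small) (auto dest: meet)
        then show ?thesis by auto
      qed simp
      then obtain F where F: "i \<in> M \<longrightarrow> (\<forall>j\<in>underS r i \<inter> L. b i F \<notin> C j (snd (h j)))"
        by blast
      \<comment> \<open>The point is fixed first; the set must then avoid it along with all earlier
        points.\<close>
      define Y where "Y = insert (b i F) ((\<lambda>j. b j (fst (h j))) ` (underS r i \<inter> M))"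
      have "|{b i F}| <o |UNIV :: 'f set|"
        using inf by (intro finite_ordLess_infinite card_of_Well_order) (simp_all add: Field_card_of)
      moreover have "|(\<lambda>j. b j (fst (h j))) ` (underS r i \<inter> M)| <o |UNIV :: 'f set|"
        using small card_of_image ordLeq_ordLess_trans by blast
      ultimately have "|Y| <o |UNIV :: 'f set|"
        using card_of_Un_ordLess_infinite[OF inf] unfolding Y_def by (metis insert_is_Un)
      then have "\<exists>G. \<forall>y\<in>Y. \<not> (i \<in> L \<and> y \<in> C i G)"
        by (rule ex_unrelated) (auto dest: disj)
      then obtain G where "\<forall>y\<in>Y. \<not> (i \<in> L \<and> y \<in> C i G)"
        by blast
      then have "P h i (F, G)"
        using F unfolding P_def Y_def by auto
      then show ?thesis by blast
    qed
  qed
  then obtain h where h: "\<And>i. P h i (h i)"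
    by blast
  have "b i (fst (h i)) \<notin> C j (snd (h j))" if "i \<in> M" "j \<in> L" for i j
  proof -
    \<comment> \<open>The conflict between \<open>i\<close> and \<open>j\<close> was excluded at the
      later of the two stages, or within the common stage.\<close>
    have "i = j \<or> i \<in> underS r j \<or> j \<in> underS r i"
      using wo field unfolding well_order_on_def linear_order_on_def total_on_def underS_def
      by auto
    then show ?thesis
      using h[of i] h[of j] that unfolding P_def by auto
  qed
  then show ?thesis
    by (intro exI[of _ "fst \<circ> h"] exI[of _ "snd \<circ> h"]) auto
qed

text \<open>Run through the countably many pairs \<open>(k, n)\<close> and give each an element of
  \<open>S k\<close> that differs from the finitely many chosen before. The elements chosen for the
  pairs \<open>(k, _)\<close> form \<open>D k\<close>.\<close>

lemma ex_disjoint_refinement: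
  fixes S :: "'k :: countable \<Rightarrow> 'a set"
  assumes "\<And>k. infinite (S k)"
  shows "\<exists>D. (\<forall>k. D k \<subseteq> S k \<and> infinite (D k)) \<and> (\<forall>k l. k \<noteq> l \<longrightarrow> D k \<inter> D l = {})"
proof -
  define P where "P h p v \<longleftrightarrow> v \<in> S (fst p) \<and> v \<notin> h ` {q. to_nat q < to_nat p}"
    for h :: "'k \<times> nat \<Rightarrow> 'a" and p :: "'k \<times> nat" and v
  have "\<exists>h. \<forall>p. P h p (h p)"
  proof (rule dependent_wf_choice[where R = "measure to_nat"])
    show "P h p v = P h' p v" if "\<And>q. (q, p) \<in> measure to_nat \<Longrightarrow> h q = h' q" for h h' p v
      using that unfolding P_def by (auto simp: image_iff)
    show "\<exists>v. P h p v" for p h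
    proof -
      have "finite {q :: 'k \<times> nat. to_nat q < to_nat p}"
        using finite_vimageI[of "{..<to_nat p}" to_nat] by (simp add: vimage_def)
      then have "infinite (S (fst p) - h ` {q. to_nat q < to_nat p})"
        using assms by auto
      then have "S (fst p) - h ` {q. to_nat q < to_nat p} \<noteq> {}"
        by (rule infinite_imp_nonempty)
      then show ?thesis
        unfolding P_def by blast
    qed
  qed simp
  then obtain h where h: "\<And>p. P h p (h p)"
    by blast
  have "h p \<noteq> h q" if "to_nat p < to_nat q" for p q :: "'k \<times> nat"
    using h[of q] that unfolding P_def by (metis (mono_tags, lifting) imageI mem_Collect_eq)
  then have inj: "inj h"
    by (metis injI linorder_neqE_nat from_nat_to_nat)
  define D where "D k = range (\<lambda>n. h (k, n))" for k
  have "infinite (D k)" for k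
    unfolding D_def by (rule range_inj_infinite) (simp add: inj_def inj_eq[OF inj])
  moreover have "D k \<subseteq> S k" for k
    using h[of "(k, _)"] unfolding D_def P_def by auto
  moreover have "D k \<inter> D l = {}" if "k \<noteq> l" for k l
    using that unfolding D_def by (auto simp: inj_eq[OF inj])
  ultimately show ?thesis
    by blast
qed

text \<open>All elements of \<open>A\<close> at even positions are kept, which gives infinitely many
  common values; those at odd positions encode \<open>F\<close>, which makes the branches
  distinct.\<close>

lemma mathias_tree_branches:
  assumes "T \<in> mathias_trees"
  shows "\<exists>b :: nat set \<Rightarrow> nat \<Rightarrow> nat. range b \<subseteq> branches T \<and> inj b \<and>
    (\<forall>F G. infinite (range (b F) \<inter> range (b G)))"
proof -
  obtain s A where T: "T = mathias_tree s A" and A: "infinite A"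
    and less: "\<forall>m\<in>s. \<forall>n\<in>A. m < n"
    using assms unfolding mathias_trees_def by blast
  define a where "a = enumerate A"
  have inj_a: "inj a" and range_a: "range a = A"
    unfolding a_def using A strict_mono_enumerate strict_mono_imp_inj_on range_enumerate by blast+
  define y where "y F = range (\<lambda>k. a (2 * k)) \<union> (\<lambda>k. a (2 * k + 1)) ` F" for F
  have y_sub: "y F \<subseteq> A" for F
    unfolding y_def using range_a by auto
  have "inj (\<lambda>k. a (2 * k))"
    using inj_eq[OF inj_a] by (simp add: inj_def)
  then have inf: "infinite (range (\<lambda>k. a (2 * k)))"
    by (rule range_inj_infinite)
  have inf_y: "infinite (s \<union> y F)" "infinite (y F)" for F
    using inf unfolding y_def by auto
  define b where "b F = enumerate (s \<union> y F)" for F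
  have range_b: "range (b F) = s \<union> y F" for F
    unfolding b_def using inf_y range_enumerate by blast
  have "b F \<in> branches T" for F
    unfolding branches_def inc_inf_def T mathias_tree_def b_def
    using strict_mono_enumerate[OF inf_y(1)] y_sub inf_y(2) by blast
  moreover have "inj b"
  proof (rule injI)
    fix F G assume "b F = b G"
    then have "s \<union> y F = s \<union> y G"
      using range_b by metis
    moreover have "s \<inter> A = {}"
      using less by blast
    ultimately have eq: "y F = y G"
      using y_sub[of F] y_sub[of G] by blast
    have "k \<in> H \<longleftrightarrow> a (2 * k + 1) \<in> y H" for k H
    proof -
      have "2 * k + 1 \<noteq> 2 * l" for l
        by presburger
      then show ?thesis
        unfolding y_def by (auto simp: inj_eq[OF inj_a])
    qed
    with eq show "F = G"
      by blast
  qed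
  moreover have "infinite (range (b F) \<inter> range (b G))" for F G
  proof (rule infinite_super[OF _ inf])
    show "range (\<lambda>k. a (2 * k)) \<subseteq> range (b F) \<inter> range (b G)"
      unfolding range_b y_def by blast
  qed
  ultimately show ?thesis
    by blast
qed

text \<open>Each node above the stem gets two infinite sets of successors, one per bit, all these
  sets being pairwise disjoint; \<open>F\<close> tells which one is used at each level. A value
  beyond the stem then determines both the node before it and the bit of its level.\<close>

lemma laver_subtrees:
  assumes "T \<in> laver_trees"
  shows "\<exists>L :: nat set \<Rightarrow> nat list set. (\<forall>F. L F \<in> laver_trees \<and> L F \<subseteq> T) \<and>
    (\<forall>F x y. x \<in> branches (L F) \<longrightarrow> y \<in> branches (L F) \<longrightarrow> x \<noteq> y \<longrightarrow> finite (range x \<inter> range y)) \<and>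
    (\<forall>F G x. x \<in> branches (L F) \<longrightarrow> x \<in> branches (L G) \<longrightarrow> F = G)"
proof -
  obtain s where tree: "is_tree T" and s: "s \<in> T"
    and succ: "\<And>t. t \<in> T \<Longrightarrow> prefix s t \<Longrightarrow> infinite {n. t @ [n] \<in> T}"
    using assms unfolding laver_trees_def by blast
  \<comment> \<open>Indices are pairs of a node and a bit. The default \<open>UNIV\<close> keeps
    \<open>S p\<close> infinite for irrelevant nodes.\<close>
  define S where "S p = (if fst p \<in> T \<and> prefix s (fst p) then {n. fst p @ [n] \<in> T} else UNIV)"
    for p :: "nat list \<times> bool"
  have "infinite (S p)" for p
    using succ unfolding S_def by auto
  from ex_disjoint_refinement[of S, OF this] obtain D where
    D_sub: "\<And>p. D p \<subseteq> S p" and D_inf: "\<And>p. infinite (D p)"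
    and D_disj: "\<And>p q n. n \<in> D p \<Longrightarrow> n \<in> D q \<Longrightarrow> p = q"
    by blast
  \<comment> \<open>Entries inside the stem are unconstrained; levels are counted from the end of
    the stem.\<close>
  define ok where "ok F t \<longleftrightarrow> (\<forall>k. length s \<le> k \<and> k < length t \<longrightarrow>
    t ! k \<in> D (take k t, k - length s \<in> F))" for F t
  define L where "L F = {t. (prefix t s \<or> prefix s t) \<and> ok F t}" for F
  have ok_prefix: "ok F u" if "ok F t" "prefix u t" for F t u
    using that unfolding ok_def prefix_def by (auto simp: nth_append)
  have ok_short: "ok F t" if "prefix t s" for F t
    using prefix_length_le[OF that] unfolding ok_def by auto
  have in_T: "prefix s t \<longrightarrow> ok F t \<longrightarrow> t \<in> T" for F t
  proof (induction t rule: rev_induct)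
    case Nil
    then show ?case using s by auto
  next
    case (snoc n t)
    show ?case
    proof (intro impI)
      assume pre: "prefix s (t @ [n])" and ok: "ok F (t @ [n])"
      show "t @ [n] \<in> T"
      proof (cases "s = t @ [n]")
        case False
        then have st: "prefix s t"
          using pre by auto
        then have "t \<in> T"
          using snoc ok_prefix[OF ok] by auto
        moreover have "n \<in> D (t, length t - length s \<in> F)"
          using ok prefix_length_le[OF st] unfolding ok_def
          by (auto dest!: spec[of _ "length t"])
        ultimately show ?thesis
          using D_sub st unfolding S_def by fastforce
      qed (use s in simp)
    qed
  qed
  have sub: "L F \<subseteq> T" for F
    using in_T s tree unfolding L_def is_tree_def by blast
  have laver: "L F \<in> laver_trees" for F
  proof -
    have sL: "s \<in> L F"
      unfolding L_def using ok_short by auto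
    have closed: "u \<in> L F" if "t \<in> L F" "prefix u t" for t u
      using that ok_prefix unfolding L_def
      by (auto intro: prefix_order.trans dest: prefix_same_cases)
    have "infinite {n. t @ [n] \<in> L F}" if "t \<in> L F" "prefix s t" for t
    proof (rule infinite_super[OF _ D_inf])
      show "D (t, length t - length s \<in> F) \<subseteq> {n. t @ [n] \<in> L F}"
        using that unfolding L_def ok_def by (auto simp: nth_append less_Suc_eq)
    qed
    moreover have "is_tree (L F)"
      using sL closed sub[of F] tree unfolding is_tree_def by blast
    ultimately show ?thesis
      using sL unfolding laver_trees_def L_def by blast
  qed
  have branch: "x n \<in> D (map x [0..<n], n - length s \<in> F)"
    if "x \<in> branches (L F)" "length s \<le> n" for x n F
  proof -
    have "ok F (map x [0..<Suc n])"
      using that unfolding branches_def L_def by blast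
    then show ?thesis
      using that(2) unfolding ok_def by (auto dest!: spec[of _ n] simp: nth_append)
  qed
  have "finite (range x \<inter> range y)"
    if x: "x \<in> branches (L F)" and y: "y \<in> branches (L F)" and "x \<noteq> y" for F x y
  proof -
    obtain n where n: "x n \<noteq> y n"
      using \<open>x \<noteq> y\<close> by blast
    \<comment> \<open>A value shared at such positions forces the nodes before it to coincide, hence
      \<open>i = j\<close> and agreement of \<open>x\<close> and \<open>y\<close> at
      \<open>n\<close>.\<close>
    have apart: "x i \<noteq> y j" if "max n (length s) < i" "length s \<le> j" for i j
    proof
      assume "x i = y j"
      then have eq: "map x [0..<i] = map y [0..<j]"
        using D_disj branch[OF x, of i] branch[OF y, of j] that by fastforce
      then have "i = j"
        by (metis length_map length_upt minus_nat.diff_0)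
      with eq that n show False
        by auto
    qed
    then have "range x \<inter> range y \<subseteq> x ` {..max n (length s)} \<union> y ` {..<length s}"
    proof (intro subsetI)
      fix v assume "v \<in> range x \<inter> range y"
      then obtain i j where "v = x i" "v = y j"
        by blast
      then show "v \<in> x ` {..max n (length s)} \<union> y ` {..<length s}"
        using apart[of i j] by (metis UnI1 UnI2 atMost_iff imageI lessThan_iff not_le)
    qed
    then show ?thesis
      by (rule finite_subset) auto
  qed
  moreover have "F = G" if x: "x \<in> branches (L F)" "x \<in> branches (L G)" for F G x
  proof (rule set_eqI)
    fix j
    show "j \<in> F \<longleftrightarrow> j \<in> G"
      using D_disj[OF branch[OF x(1), of "length s + j"] branch[OF x(2), of "length s + j"]] by simp
  qed
  ultimately show ?thesis
    using laver sub by (intro exI[of _ L] conjI allI impI) assumption+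
qed

theorem theorem2p5:
  "\<exists>X. X \<subseteq> inc_inf \<and> X \<in> laver_ideal \<and> X \<notin> mathias_ideal"
proof -
  obtain b :: "nat list set \<Rightarrow> nat set \<Rightarrow> nat \<Rightarrow> nat" where
    b: "\<And>T. T \<in> mathias_trees \<Longrightarrow> range (b T) \<subseteq> branches T \<and> inj (b T) \<and>
      (\<forall>F G. infinite (range (b T F) \<inter> range (b T G)))"
    using mathias_tree_branches by metis
  obtain L :: "nat list set \<Rightarrow> nat set \<Rightarrow> nat list set" where
    L: "\<And>T F. T \<in> laver_trees \<Longrightarrow> L T F \<in> laver_trees \<and> L T F \<subseteq> T"
      "\<And>T F x y. T \<in> laver_trees \<Longrightarrow> x \<in> branches (L T F) \<Longrightarrow> y \<in> branches (L T F) \<Longrightarrow>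
        x \<noteq> y \<Longrightarrow> finite (range x \<inter> range y)"
      "\<And>T F G x. T \<in> laver_trees \<Longrightarrow> x \<in> branches (L T F) \<Longrightarrow> x \<in> branches (L T G) \<Longrightarrow> F = G"
    using laver_subtrees by metis
  have "\<exists>f g. \<forall>S\<in>mathias_trees. \<forall>T\<in>laver_trees. b S (f S) \<notin> branches (L T (g T))"
  proof (rule ex_transversal_selection)
    show "infinite (UNIV :: nat set set)"
      by (simp add: Finite_Set.finite_set)
    \<comment> \<open>Finite sequences are countable, so there are at most as many trees as subsets
      of \<open>nat\<close>.\<close>
    have "inj (image to_nat :: nat list set \<Rightarrow> nat set)"
      by (simp add: inj_image_eq_iff inj_def)
    then show "|UNIV :: nat list set set| \<le>o |UNIV :: nat set set|"
      using card_of_ordLeq by blast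
  next
    \<comment> \<open>Two different branches in \<open>L T H\<close> share only finitely many
      values, but two picked from \<open>b S\<close> share infinitely many.\<close>
    fix S T F G H
    assume "S \<in> mathias_trees" "T \<in> laver_trees"
      "b S F \<in> branches (L T H)" "b S G \<in> branches (L T H)"
    then show "F = G"
      using b[of S] L(2)[of T "b S F" H "b S G"] by (meson injD)
  qed (fact L(3))
  then obtain f g where
    fg: "\<And>S T. S \<in> mathias_trees \<Longrightarrow> T \<in> laver_trees \<Longrightarrow> b S (f S) \<notin> branches (L T (g T))"
    by blast
  define X where "X = (\<lambda>S. b S (f S)) ` mathias_trees"
  have in_branches: "b S (f S) \<in> branches S" if "S \<in> mathias_trees" for S
    using b[OF that] by blast
  then have "X \<subseteq> inc_inf"
    unfolding X_def branches_def by blast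
  moreover have "branches (L T (g T)) \<inter> X = {}" if "T \<in> laver_trees" for T
    using fg that unfolding X_def by blast
  ultimately have "X \<in> laver_ideal"
    using L(1) unfolding laver_ideal_def tree_ideal_def
    by (intro CollectI conjI ballI) metis+
  moreover have "X \<notin> mathias_ideal"
  proof
    assume "X \<in> mathias_ideal"
    \<comment> \<open>Membership in the ideal only speaks about subtrees of a given Mathias tree, so
      one such tree is needed to start from.\<close>
    moreover have "mathias_tree {} UNIV \<in> mathias_trees"
      unfolding mathias_trees_def using infinite_UNIV_nat by blast
    ultimately obtain S where "S \<in> mathias_trees" "branches S \<inter> X = {}"
      unfolding mathias_ideal_def tree_ideal_def by blast
    then show False
      using in_branches unfolding X_def by blast
  qed
  ultimately show ?thesis
    using \<open>X \<subseteq> inc_inf\<close> by blast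
qed

end
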